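(* Let $t\in\mathcal T$, $\mathcal G_u\subseteq\mathcal G$, $\mathcal J_u\subseteq\mathcal J$, $\{\delta_{ugd}\}\in[0,1]^{\mathcal G_u\times\{0,\dots,J\}}$ and $K_u\in\mathbb R$. Define $$\mathcal H=\Big\{S\subseteq\mathcal G_u\times\{0,\dots,J\}:\ \sum_{(g,d)\in S}d\le J-|\mathcal J_u|,\ \text{and}\ |\{(g',d)\in S:g'=g\}|\le1\ \ \forall g\in\mathcal G_u\Big\}.$$ If $\sum_{(g,d)\in S}\delta_{ugd}\le K_u$ for all $S\in\mathcal H$, then the following inequality is valid for $\mathrm{conv}(\mathcal F)$, where $\mathcal F$ is the feasible region of the integer problem (SP) defined in the context: $$\sum_{g\in\mathcal G_u}\sum_{q\in\mathcal Q_g}\sum_{d=0}^{J}\mathbb 1[B_{qt}=d]\,\delta_{ugd}\,y_q+\sum_{j\in\mathcal J_u}\sum_{p\in\mathcal P_j}\mathbb 1\Big[\sum_{g\in\mathcal G_u}A_{pgt}=0\Big]z_p\le|\mathcal J_u|+K_u.$$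
   Context: **Networks.** Time periods $\mathcal T=\{1,\dots,T\}$ with sink period $T+1$; $\mathcal G$ is a finite set of fires; $\mathcal J$ is a finite set of crews, $J=|\mathcal J|$. Crew networks. Crew $j$ has a finite location set $\mathcal L_j$ containing its home base $b_j$, its initial location $\ell^1_j$ and the fires $\mathcal G_j\subseteq\mathcal G$ in its jurisdiction. Nodes: $\mathcal N_j=(\mathcal L_j\times\{2,\dots,T+1\}\times\{0,1\})\cup\{(\ell^1_j,1,0)\}$; a node is (location, time, rested indicator). Arcs $\mathcal A_j$: traveling arcs $(\ell_1,t_1,r)\to(\ell_2,t_2,r)$, $\ell_1\ne\ell_2$, where $t_2-t_1\geq 1$ is the travel time from $\ell_1$ to $\ell_2$ rounded up to whole periods; working arcs $(g,t,r)\to(g,t+1,r)$, $g\in\mathcal G_j$, $t\in\mathcal T$; resting arcs $(b_j,t,0)\to(b_j,t',1)$ with $t'-t\ge\gamma$ ($\gamma\geq 1$ the rest duration) and base arcs $(b_j,t,r)\to(b_j,t+1,r)$. Traveling and working arcs leaving nodes with time $>R_j$ and rested indicator $0$ are removed ($R_j$ is a given latest rest time). Each arc has a cost $c_a$. $\mathcal P_j$ (crew routes) is the set of directed paths from $(\ell^1_j,1,0)$ to a node of time $T+1$. $\mathcal A_j^{gt}$ is the set of arcs leaving $(g,t,0)$ or $(g,t,1)$; $A_{pgt}=1$ if route $p$ uses an arc of $\mathcal A_j^{gt}$, else $0$; $c_p$ is the sum of the arc costs of $p$. Fire networks. Fire $g$ has a finite state set $\mathcal S_g$, initial state $s^1_g$,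 transition functions $f_{gt}$ and a rounding map $\lceil\cdot\rceil_{\mathcal S_g}$ onto $\mathcal S_g$. Nodes: $(\mathcal S_g\times\{2,\dots,T+1\})\cup\{(s_g^1,1)\}$. There is an arc $a$ from $(s_1,t)$ to $(s_2,t+1)$ iff $\lceil f_{gt}(s_1,x)\rceil_{\mathcal S_g}=s_2$ for some $x\in\{0,\dots,J\}$, and $x_a$ is the smallest such $x$; it has a cost $d_a$. $\mathcal B_g$ is the arc set, $\mathcal B_g^t$ the arcs leaving time $t$ with $x_a>0$. $\mathcal Q_g$ (suppression plans) is the set of directed paths from $(s_g^1,1)$ to a node of time $T+1$; $B_{qt}=\sum x_a$ over arcs $a\in\mathcal B_g^t$ of $q$; $d_q$ is the sum of the arc costs of $q$. **Problem (SP).** Minimize $\sum_{j}\sum_{p\in\mathcal P_j}c_pz_p+\sum_g\sum_{q\in\mathcal Q_g}d_qy_q$ over binary $y,z$ subject to $\sum_{q\in\mathcal Q_g}y_q=1$ for all $g\in\mathcal G$; $\sum_{p\in\mathcal P_j}z_p=1$ for all $j\in\mathcal J$; and $\sum_{j}\sum_{p\in\mathcal P_j}A_{pgt}z_p-\sum_{q\in\mathcal Q_g}B_{qt}y_q\ge0$ for all $g\in\mathcal G,t\in\mathcal T$. $\mathcal F$ denotes the set of feasible $(y,z)$. *)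

theory Defs
  imports
    "HOL-Analysis.Analysis"
    "HOL-Library.Function_Algebras"
    "Graph_Theory.Graph_Theory"
begin

text \<open>Pointwise real vector space structure on functions, so that \<open>convex hull\<close> applies to sets of
  functions.\<close>

instantiation "fun" :: (type, real_vector) real_vector
begin

definition scaleR_fun :: "real \<Rightarrow> ('a \<Rightarrow> 'b) \<Rightarrow> 'a \<Rightarrow> 'b" where
  "scaleR_fun c f = (\<lambda>x. c *\<^sub>R f x)"

instance
  by standard
    (simp_all add: scaleR_fun_def fun_eq_iff scaleR_add_right scaleR_add_left)

end


text \<open>A node of a crew network is (location, time, rested); the rested indicator 1 is \<open>True\<close>.
  Arcs carry their kind, since a working and a base arc may join the same two nodes when a home
  base is itself a fire.\<close>

datatype arc_kind = Travel | Work | Rest | Base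

type_synonym 'l crew_node = "'l \<times> nat \<times> bool"
type_synonym 'l crew_arc = "arc_kind \<times> 'l crew_node \<times> 'l crew_node"
type_synonym 's fire_node = "'s \<times> nat"
type_synonym 's fire_arc = "'s fire_node \<times> 's fire_node"

text \<open>Fires are particular locations, hence they share the type \<open>'l\<close>. Travel times are not yet
  rounded to whole periods.\<close>

record ('l, 'j, 's) sp_data =
  horizon :: nat
  fires :: "'l set"
  crews :: "'j set"
  locs :: "'j \<Rightarrow> 'l set"
  home :: "'j \<Rightarrow> 'l"
  init_loc :: "'j \<Rightarrow> 'l"
  crew_fires :: "'j \<Rightarrow> 'l set"
  travel_time :: "'j \<Rightarrow> 'l \<Rightarrow> 'l \<Rightarrow> real"
  rest_duration :: real
  latest_rest :: "'j \<Rightarrow> real"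
  crew_arc_cost :: "'j \<Rightarrow> 'l crew_arc \<Rightarrow> real"
  fire_states :: "'l \<Rightarrow> 's set"
  init_state :: "'l \<Rightarrow> 's"
  transition :: "'l \<Rightarrow> nat \<Rightarrow> 's \<Rightarrow> nat \<Rightarrow> 's"
  round_state :: "'l \<Rightarrow> 's \<Rightarrow> 's"
  fire_arc_cost :: "'l \<Rightarrow> 's fire_arc \<Rightarrow> real"

locale sp_instance =
  fixes I :: "('l, 'j, 's) sp_data"
  assumes finite_fires: "finite (fires I)"
    and finite_crews: "finite (crews I)"
    and finite_locs: "j \<in> crews I \<Longrightarrow> finite (locs I j)"
    and home_in_locs: "j \<in> crews I \<Longrightarrow> home I j \<in> locs I j"
    and init_loc_in_locs: "j \<in> crews I \<Longrightarrow> init_loc I j \<in> locs I j"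
    and crew_fires_locs: "j \<in> crews I \<Longrightarrow> crew_fires I j \<subseteq> locs I j"
    and crew_fires_fires: "j \<in> crews I \<Longrightarrow> crew_fires I j \<subseteq> fires I"
    and travel_time_pos: "\<lbrakk>j \<in> crews I; l1 \<in> locs I j; l2 \<in> locs I j; l1 \<noteq> l2\<rbrakk>
      \<Longrightarrow> travel_time I j l1 l2 > 0"
    and rest_duration_ge_1: "rest_duration I \<ge> 1"
    and finite_fire_states: "g \<in> fires I \<Longrightarrow> finite (fire_states I g)"
    and round_state_onto: "g \<in> fires I \<Longrightarrow> range (round_state I g) = fire_states I g"

definition periods :: "('l, 'j, 's) sp_data \<Rightarrow> nat set" where
  "periods I = {1..horizon I}"


subsection \<open>Crew networks\<close>

definition crew_start :: "('l, 'j, 's) sp_data \<Rightarrow> 'j \<Rightarrow> 'l crew_node" where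
  "crew_start I j = (init_loc I j, 1, False)"

definition crew_nodes :: "('l, 'j, 's) sp_data \<Rightarrow> 'j \<Rightarrow> 'l crew_node set" where
  "crew_nodes I j = locs I j \<times> {2..horizon I + 1} \<times> UNIV \<union> {crew_start I j}"

definition travel_arcs :: "('l, 'j, 's) sp_data \<Rightarrow> 'j \<Rightarrow> 'l crew_arc set" where
  "travel_arcs I j = {(Travel, (l1, t1, r), (l2, t2, r)) | l1 l2 t1 t2 r.
     l1 \<noteq> l2 \<and> t2 = t1 + nat \<lceil>travel_time I j l1 l2\<rceil>}"

definition work_arcs :: "('l, 'j, 's) sp_data \<Rightarrow> 'j \<Rightarrow> 'l crew_arc set" where
  "work_arcs I j = {(Work, (g, t, r), (g, t + 1, r)) | g t r. g \<in> crew_fires I j \<and> t \<in> periods I}"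

definition rest_arcs :: "('l, 'j, 's) sp_data \<Rightarrow> 'j \<Rightarrow> 'l crew_arc set" where
  "rest_arcs I j = {(Rest, (home I j, t, False), (home I j, t', True)) | t t'.
     real t' - real t \<ge> rest_duration I}"

definition base_arcs :: "('l, 'j, 's) sp_data \<Rightarrow> 'j \<Rightarrow> 'l crew_arc set" where
  "base_arcs I j = {(Base, (home I j, t, r), (home I j, t + 1, r)) | t r. True}"

text \<open>Traveling and working arcs that leave an unrested node after the latest rest time.\<close>

definition overdue_arcs :: "('l, 'j, 's) sp_data \<Rightarrow> 'j \<Rightarrow> 'l crew_arc set" where
  "overdue_arcs I j = {(k, (l, t, r), v) | k l t r v.
     k \<in> {Travel, Work} \<and> real t > latest_rest I j \<and> \<not> r}"

definition crew_arcs :: "('l, 'j, 's) sp_data \<Rightarrow> 'j \<Rightarrow> 'l crew_arc set" where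
  "crew_arcs I j =
     {(k, u, v) \<in> travel_arcs I j \<union> work_arcs I j \<union> rest_arcs I j \<union> base_arcs I j.
        u \<in> crew_nodes I j \<and> v \<in> crew_nodes I j} - overdue_arcs I j"

definition crew_network :: "('l, 'j, 's) sp_data \<Rightarrow> 'j \<Rightarrow> ('l crew_node, 'l crew_arc) pre_digraph"
  where
  "crew_network I j = \<lparr>verts = crew_nodes I j, arcs = crew_arcs I j,
     tail = (\<lambda>(k, u, v). u), head = (\<lambda>(k, u, v). v)\<rparr>"

definition crew_routes :: "('l, 'j, 's) sp_data \<Rightarrow> 'j \<Rightarrow> 'l crew_arc list set" where
  "crew_routes I j = {p. \<exists>l r.
     pre_digraph.apath (crew_network I j) (crew_start I j) p (l, horizon I + 1, r)}"

definition crew_arcs_at :: "('l, 'j, 's) sp_data \<Rightarrow> 'j \<Rightarrow> 'l \<Rightarrow> nat \<Rightarrow> 'l crew_arc set" where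
  "crew_arcs_at I j g t =
     {a \<in> crew_arcs I j. tail (crew_network I j) a \<in> {(g, t, False), (g, t, True)}}"

definition route_works :: "('l, 'j, 's) sp_data \<Rightarrow> 'j \<Rightarrow> 'l crew_arc list \<Rightarrow> 'l \<Rightarrow> nat \<Rightarrow> nat" where
  "route_works I j p g t = (if set p \<inter> crew_arcs_at I j g t \<noteq> {} then 1 else 0)"

definition route_cost :: "('l, 'j, 's) sp_data \<Rightarrow> 'j \<Rightarrow> 'l crew_arc list \<Rightarrow> real" where
  "route_cost I j p = (\<Sum>a\<leftarrow>p. crew_arc_cost I j a)"


subsection \<open>Fire networks\<close>

definition fire_start :: "('l, 'j, 's) sp_data \<Rightarrow> 'l \<Rightarrow> 's fire_node" where
  "fire_start I g = (init_state I g, 1)"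

definition fire_nodes :: "('l, 'j, 's) sp_data \<Rightarrow> 'l \<Rightarrow> 's fire_node set" where
  "fire_nodes I g = fire_states I g \<times> {2..horizon I + 1} \<union> {fire_start I g}"

fun leads_to :: "('l, 'j, 's) sp_data \<Rightarrow> 'l \<Rightarrow> 's fire_arc \<Rightarrow> nat \<Rightarrow> bool" where
  "leads_to I g ((s1, t), (s2, t')) x \<longleftrightarrow>
     x \<le> card (crews I) \<and> round_state I g (transition I g t s1 x) = s2"

definition fire_arcs :: "('l, 'j, 's) sp_data \<Rightarrow> 'l \<Rightarrow> 's fire_arc set" where
  "fire_arcs I g = {((s1, t), (s2, t + 1)) | s1 t s2.
     (s1, t) \<in> fire_nodes I g \<and> (s2, t + 1) \<in> fire_nodes I g \<and>
     (\<exists>x. leads_to I g ((s1, t), (s2, t + 1)) x)}"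

definition crew_demand :: "('l, 'j, 's) sp_data \<Rightarrow> 'l \<Rightarrow> 's fire_arc \<Rightarrow> nat" where
  "crew_demand I g a = (LEAST x. leads_to I g a x)"

definition fire_network :: "('l, 'j, 's) sp_data \<Rightarrow> 'l \<Rightarrow> ('s fire_node, 's fire_arc) pre_digraph"
  where
  "fire_network I g = \<lparr>verts = fire_nodes I g, arcs = fire_arcs I g, tail = fst, head = snd\<rparr>"

definition fire_plans :: "('l, 'j, 's) sp_data \<Rightarrow> 'l \<Rightarrow> 's fire_arc list set" where
  "fire_plans I g = {q. \<exists>s.
     pre_digraph.apath (fire_network I g) (fire_start I g) q (s, horizon I + 1)}"

definition fire_arcs_at :: "('l, 'j, 's) sp_data \<Rightarrow> 'l \<Rightarrow> nat \<Rightarrow> 's fire_arc set" where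
  "fire_arcs_at I g t = {((s1, t1), v) \<in> fire_arcs I g. t1 = t \<and> crew_demand I g ((s1, t1), v) > 0}"

definition plan_demand :: "('l, 'j, 's) sp_data \<Rightarrow> 'l \<Rightarrow> 's fire_arc list \<Rightarrow> nat \<Rightarrow> nat" where
  "plan_demand I g q t = (\<Sum>a \<in> set q \<inter> fire_arcs_at I g t. crew_demand I g a)"

definition plan_cost :: "('l, 'j, 's) sp_data \<Rightarrow> 'l \<Rightarrow> 's fire_arc list \<Rightarrow> real" where
  "plan_cost I g q = (\<Sum>a\<leftarrow>q. fire_arc_cost I g a)"


subsection \<open>The integer problem\<close>

text \<open>Variables are indexed by \<open>y g q\<close> and \<open>z j p\<close>, because distinct fires (or crews) may have
  networks sharing a path.\<close>

type_synonym ('l, 'j, 's) sp_point =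
  "('l \<Rightarrow> 's fire_arc list \<Rightarrow> real) \<times> ('j \<Rightarrow> 'l crew_arc list \<Rightarrow> real)"

definition sp_objective :: "('l, 'j, 's) sp_data \<Rightarrow> ('l, 'j, 's) sp_point \<Rightarrow> real" where
  "sp_objective I = (\<lambda>(y, z).
     (\<Sum>j\<in>crews I. \<Sum>p\<in>crew_routes I j. route_cost I j p * z j p) +
     (\<Sum>g\<in>fires I. \<Sum>q\<in>fire_plans I g. plan_cost I g q * y g q))"

text \<open>A vector over the plans and routes is represented by its extension by 0 to all arguments, so
  that the feasible points form a subset of a finite-dimensional coordinate subspace.\<close>

definition sp_feasible :: "('l, 'j, 's) sp_data \<Rightarrow> ('l, 'j, 's) sp_point set" where
  "sp_feasible I = {(y, z).
     (\<forall>g q. y g q \<in> {0, 1}) \<and> (\<forall>g q. \<not> (g \<in> fires I \<and> q \<in> fire_plans I g) \<longrightarrow> y g q = 0) \<and>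
     (\<forall>j p. z j p \<in> {0, 1}) \<and> (\<forall>j p. \<not> (j \<in> crews I \<and> p \<in> crew_routes I j) \<longrightarrow> z j p = 0) \<and>
     (\<forall>g\<in>fires I. (\<Sum>q\<in>fire_plans I g. y g q) = 1) \<and>
     (\<forall>j\<in>crews I. (\<Sum>p\<in>crew_routes I j. z j p) = 1) \<and>
     (\<forall>g\<in>fires I. \<forall>t\<in>periods I.
        (\<Sum>j\<in>crews I. \<Sum>p\<in>crew_routes I j. real (route_works I j p g t) * z j p)
        - (\<Sum>q\<in>fire_plans I g. real (plan_demand I g q t) * y g q) \<ge> 0)}"

definition allotments :: "('l, 'j, 's) sp_data \<Rightarrow> 'l set \<Rightarrow> 'j set \<Rightarrow> ('l \<times> nat) set set" where
  "allotments I Gu Ju = {S. S \<subseteq> Gu \<times> {0..card (crews I)} \<and>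
     int (\<Sum>(g, d)\<in>S. d) \<le> int (card (crews I)) - int (card Ju) \<and>
     (\<forall>g\<in>Gu. card {(g', d) \<in> S. g' = g} \<le> 1)}"


subsection \<open>Finiteness of the path sets\<close>

text \<open>The sums over routes and plans are sums over finite sets, so they are not silently 0.\<close>

lemma (in sp_instance) finite_crew_routes:
  assumes "j \<in> crews I"
  shows "finite (crew_routes I j)"
proof -
  have fn: "finite (crew_nodes I j)"
    using finite_locs[OF assms] by (simp add: crew_nodes_def)
  have fk: "finite (UNIV :: arc_kind set)"
  proof -
    have "(UNIV :: arc_kind set) = {Travel, Work, Rest, Base}"
      using arc_kind.exhaust by blast
    then show ?thesis by (metis finite.emptyI finite_insert)
  qed
  have "crew_arcs I j \<subseteq> UNIV \<times> crew_nodes I j \<times> crew_nodes I j"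
    by (auto simp: crew_arcs_def)
  then have fa: "finite (crew_arcs I j)"
    using fn fk by (meson finite_SigmaI finite_subset)
  interpret fin_digraph "crew_network I j"
    by standard (auto simp: crew_network_def fn fa, auto simp: crew_arcs_def)
  have "crew_routes I j \<subseteq> (\<Union>v\<in>verts (crew_network I j). {p. apath (crew_start I j) p v})"
    unfolding crew_routes_def by (auto simp: apath_def)
  moreover have "finite \<dots>"
    using finite_verts apaths_finite by blast
  ultimately show ?thesis by (rule finite_subset)
qed

lemma (in sp_instance) finite_fire_plans:
  assumes "g \<in> fires I"
  shows "finite (fire_plans I g)"
proof -
  have fn: "finite (fire_nodes I g)"
    using finite_fire_states[OF assms] by (simp add: fire_nodes_def)
  have "fire_arcs I g \<subseteq> fire_nodes I g \<times> fire_nodes I g"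
    by (auto simp: fire_arcs_def)
  then have fa: "finite (fire_arcs I g)"
    using fn by (meson finite_SigmaI finite_subset)
  interpret fin_digraph "fire_network I g"
    by standard (auto simp: fire_network_def fn fa, auto simp: fire_arcs_def)
  have "fire_plans I g \<subseteq> (\<Union>v\<in>verts (fire_network I g). {p. apath (fire_start I g) p v})"
    unfolding fire_plans_def by (auto simp: apath_def)
  moreover have "finite \<dots>"
    using finite_verts apaths_finite by blast
  ultimately show ?thesis by (rule finite_subset)
qed

end

theory Submission
  imports Defs
begin

text \<open>
  The left-hand side is linear in \<open>(y, z)\<close>, so the inequality only has to be checked at the points of
  \<open>sp_feasible I\<close>. Such a point chooses one plan for each fire and one route for each crew.
  Let \<open>D g\<close> be the demand of the chosen plan of \<open>g\<close> in period \<open>t\<close>. Time increases strictly along a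
  crew route, so a route leaves at most one node of time \<open>t\<close> and its crew works on at most one fire
  in that period (\<open>route_works_sum_le_1\<close>).

  Suppose that \<open>k\<close> crews of \<open>Ju\<close> work on no fire of \<open>Gu\<close>. Since the other crews serve at most one
  fire each, the linking constraints give \<open>(\<Sum>g\<in>Gu. D g) \<le> J - k = (J - card Ju) + m\<close>, where
  \<open>m = card Ju - k\<close>. The set of all pairs \<open>(g, D g)\<close> may therefore exceed the capacity that defines
  \<open>allotments\<close>, but by at most \<open>m\<close>. Deleting a fire of positive demand lowers the total demand by
  at least 1 and the total weight \<open>\<delta>\<close> by at most 1, so at most \<open>m\<close> deletions produce an element of
  \<open>allotments\<close> and lose at most \<open>m\<close> in weight (\<open>subset_within_capacity\<close>). Hence
  \<open>(\<Sum>g\<in>Gu. \<delta> g (D g)) \<le> K + m\<close>, and adding \<open>k\<close> gives the bound \<open>card Ju + K\<close>.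
\<close>

section \<open>Selection and deletion over finite sets\<close>

lemma binary_sum_1_selects:
  fixes f :: "'a \<Rightarrow> real"
  assumes "finite A" and "\<And>a. a \<in> A \<Longrightarrow> f a \<in> {0, 1}" and "sum f A = 1"
  shows "\<exists>a\<in>A. \<forall>h. (\<Sum>b\<in>A. h b * f b) = h a"
proof -
  from assms(3) obtain a where a: "a \<in> A" "f a \<noteq> 0"
    by (metis sum.neutral zero_neq_one)
  then have fa: "f a = 1"
    using assms(2) by blast
  have "sum f (A - {a}) = 0"
    using assms(1,3) a fa by (simp add: sum_diff1)
  then have "\<forall>b\<in>A - {a}. f b = 0"
    using assms(1,2) by (subst (asm) sum_nonneg_eq_0_iff) force+
  then have "(\<Sum>b\<in>A. h b * f b) = h a" for h
    using assms(1) a fa by (simp add: sum.remove)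
  with a show ?thesis by blast
qed

text \<open>Every deleted element of positive size frees at least one unit of capacity and costs at most
  one unit of weight; if no element has positive size, there is no excess left to remove.\<close>

lemma subset_within_capacity:
  fixes d :: "'a \<Rightarrow> nat" and w :: "'a \<Rightarrow> real"
  assumes "finite A" and "\<And>a. a \<in> A \<Longrightarrow> w a \<le> 1" and "sum d A \<le> c + m"
  obtains B where "B \<subseteq> A" and "sum d B \<le> c" and "sum w A \<le> sum w B + real m"
  using assms
proof (induction m arbitrary: A thesis)
  case 0
  then show ?case by (intro "0.prems"(1)[of A]) auto
next
  case (Suc m)
  show ?case
  proof (cases "\<exists>a\<in>A. d a > 0")
    case True
    then obtain a where a: "a \<in> A" "d a > 0" by blast
    have "sum d A = d a + sum d (A - {a})"
      using Suc.prems(2) a by (simp add: sum.remove)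
    then have le: "sum d (A - {a}) \<le> c + m"
      using Suc.prems(4) a by simp
    obtain B where B: "B \<subseteq> A - {a}" "sum d B \<le> c" "sum w (A - {a}) \<le> sum w B + real m"
    proof (rule Suc.IH[of "A - {a}"])
      show "finite (A - {a})" using Suc.prems(2) by simp
      show "sum d (A - {a}) \<le> c + m" by (fact le)
    qed (use Suc.prems(3) in auto)
    have "sum w A = w a + sum w (A - {a})"
      using Suc.prems(2) a by (simp add: sum.remove)
    then have "sum w A \<le> sum w B + real (Suc m)"
      using B(3) Suc.prems(3)[OF a(1)] by simp
    with B show ?thesis by (intro Suc.prems(1)[of B]) auto
  next
    case False
    then have "sum d A = 0" by simp
    then show ?thesis by (intro Suc.prems(1)[of A]) auto
  qed
qed

section \<open>A crew works on at most one fire per period\<close>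

text \<open>An awalk along which a potential increases strictly visits each level of the potential at most
  once.\<close>

lemma (in wf_digraph) awalk_increasing_tail_inj:
  fixes f :: "'a \<Rightarrow> nat"
  assumes "\<And>a. a \<in> arcs G \<Longrightarrow> f (tail G a) < f (head G a)" and "awalk u p v"
  shows "(\<forall>a\<in>set p. f u \<le> f (tail G a)) \<and> inj_on (\<lambda>a. f (tail G a)) (set p)"
  using assms(2)
proof (induction p arbitrary: u)
  case Nil
  then show ?case by simp
next
  case (Cons a p)
  then have a: "a \<in> arcs G" "u = tail G a" "awalk (head G a) p v"
    by (auto simp: awalk_Cons_iff)
  have lt: "f (tail G a) < f (tail G b)" if "b \<in> set p" for b
    using Cons.IH[OF a(3)] assms(1)[OF a(1)] that by fastforce
  show ?case
    using Cons.IH[OF a(3)] lt a(2) by (fastforce simp: inj_on_def)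
qed

context sp_instance
begin

lemma crew_arc_time_increasing:
  assumes "j \<in> crews I" and "(k, (l1, t1, r1), (l2, t2, r2)) \<in> crew_arcs I j"
  shows "t1 < t2"
proof -
  have nodes: "l1 \<in> locs I j" "l2 \<in> locs I j"
    using assms init_loc_in_locs by (auto simp: crew_arcs_def crew_nodes_def crew_start_def)
  \<comment> \<open>Travel times are positive between distinct locations, so rounding up gives at least 1.\<close>
  show ?thesis
    using assms travel_time_pos[OF assms(1) nodes] rest_duration_ge_1
    by (auto simp: crew_arcs_def travel_arcs_def work_arcs_def rest_arcs_def base_arcs_def)
qed

lemma crew_route_tail_time_inj:
  assumes "j \<in> crews I" and "p \<in> crew_routes I j"
  shows "inj_on (\<lambda>a. fst (snd (tail (crew_network I j) a))) (set p)"
proof -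
  interpret wf_digraph "crew_network I j"
    by standard (auto simp: crew_network_def crew_arcs_def)
  obtain v where "awalk (crew_start I j) p v"
    using assms(2) by (auto simp: crew_routes_def apath_def)
  moreover have "fst (snd (tail (crew_network I j) a)) < fst (snd (head (crew_network I j) a))"
    if "a \<in> arcs (crew_network I j)" for a
    using that crew_arc_time_increasing[OF assms(1)] by (cases a) (auto simp: crew_network_def)
  ultimately show ?thesis
    using awalk_increasing_tail_inj[where f = "\<lambda>x. fst (snd x)"] by blast
qed

lemma route_works_sum_le_1:
  assumes "j \<in> crews I" and "p \<in> crew_routes I j"
  shows "(\<Sum>g\<in>A. route_works I j p g t) \<le> 1"
proof -
  have unique: "g = g'" if works: "route_works I j p g t \<noteq> 0" "route_works I j p g' t \<noteq> 0" for g g'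
  proof -
    obtain a b where "a \<in> set p" "a \<in> crew_arcs_at I j g t" "b \<in> set p" "b \<in> crew_arcs_at I j g' t"
      using works unfolding route_works_def by (metis disjoint_iff)
    moreover from this have "a = b"
      by (intro inj_onD[OF crew_route_tail_time_inj[OF assms]]) (auto simp: crew_arcs_at_def)
    ultimately show ?thesis by (auto simp: crew_arcs_at_def)
  qed
  show ?thesis
  proof (cases "finite A \<and> (\<exists>g\<in>A. route_works I j p g t \<noteq> 0)")
    case True
    then obtain g where g: "finite A" "g \<in> A" "route_works I j p g t \<noteq> 0" by blast
    then have "(\<Sum>g'\<in>A. route_works I j p g' t) = route_works I j p g t"
      using unique by (subst sum.remove[of _ g]) force+
    then show ?thesis by (simp add: route_works_def)
  next
    case False
    then have "(\<Sum>g\<in>A. route_works I j p g t) = 0" by (auto intro: sum.neutral)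
    then show ?thesis by simp
  qed
qed

section \<open>Validity at integer points\<close>

text \<open>Here \<open>U\<close> stands for the idle crews of \<open>Ju\<close>. Each of them lowers the available capacity by one
  and contributes one to the left-hand side; each busy crew of \<open>Ju\<close> leaves one unit in
  \<open>card Ju\<close> that pays for deleting one fire from the allotment.\<close>

lemma allotment_bound:
  assumes "Gu \<subseteq> fires I" and "Ju \<subseteq> crews I" and "U \<subseteq> Ju"
    and weights: "\<And>g d. g \<in> Gu \<Longrightarrow> d \<le> card (crews I) \<Longrightarrow> \<delta> g d \<le> 1"
    and bound: "\<And>S. S \<in> allotments I Gu Ju \<Longrightarrow> (\<Sum>(g, d)\<in>S. \<delta> g d) \<le> K"
    and D_le: "\<And>g. g \<in> Gu \<Longrightarrow> D g \<le> card (crews I)"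
    and total: "(\<Sum>g\<in>Gu. D g) + card U \<le> card (crews I)"
  shows "(\<Sum>g\<in>Gu. \<delta> g (D g)) + real (card U) \<le> real (card Ju) + K"
proof -
  have finG: "finite Gu" and finJ: "finite Ju"
    using assms(1,2) finite_fires finite_crews finite_subset by blast+
  have cardJ: "card Ju \<le> card (crews I)" and cardU: "card U \<le> card Ju"
    using assms(2,3) finJ finite_crews by (auto intro: card_mono)
  have excess: "(\<Sum>g\<in>Gu. D g) \<le> (card (crews I) - card Ju) + (card Ju - card U)"
    using total cardJ cardU by linarith
  have "\<delta> g (D g) \<le> 1" if "g \<in> Gu" for g
    using that weights D_le by blast
  then obtain B where B: "B \<subseteq> Gu" "sum D B \<le> card (crews I) - card Ju"
      "(\<Sum>g\<in>Gu. \<delta> g (D g)) \<le> (\<Sum>g\<in>B. \<delta> g (D g)) + real (card Ju - card U)"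
    using subset_within_capacity[OF finG _ excess] by metis
  define S where "S = (\<lambda>g. (g, D g)) ` B"
  have inj: "inj_on (\<lambda>g. (g, D g)) B" by (simp add: inj_on_def)
  have "card {(g', d) \<in> S. g' = g} \<le> 1" for g
  proof -
    have "{(g', d) \<in> S. g' = g} \<subseteq> {(g, D g)}" by (auto simp: S_def)
    then show ?thesis using card_mono[of "{(g, D g)}"] by fastforce
  qed
  moreover have "(\<Sum>(g, d)\<in>S. d) = sum D B"
    by (simp add: S_def sum.reindex[OF inj])
  moreover have "S \<subseteq> Gu \<times> {0..card (crews I)}"
    using B(1) D_le by (auto simp: S_def)
  ultimately have "S \<in> allotments I Gu Ju"
    using B(2) cardJ by (simp add: allotments_def del: of_nat_sum)
  then have "(\<Sum>g\<in>B. \<delta> g (D g)) \<le> K"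
    using bound[of S] by (simp add: S_def sum.reindex[OF inj])
  then show ?thesis
    using B(3) cardU by (simp add: of_nat_diff)
qed

text \<open>At a feasible point the two double sums reduce to the weights of the demands of the chosen
  plans and to the number of idle crews of \<open>Ju\<close>. Since every demand is met by the crews, it is at most
  \<open>J\<close>, so the sum over \<open>d\<close> does pick up its weight.\<close>

lemma feasible_point_bound:
  assumes "t \<in> periods I" and Gu: "Gu \<subseteq> fires I" and Ju: "Ju \<subseteq> crews I"
    and weights: "\<And>g d. g \<in> Gu \<Longrightarrow> d \<le> card (crews I) \<Longrightarrow> \<delta> g d \<le> 1"
    and bound: "\<And>S. S \<in> allotments I Gu Ju \<Longrightarrow> (\<Sum>(g, d)\<in>S. \<delta> g d) \<le> K"
    and feasible: "(y, z) \<in> sp_feasible I"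
  shows "(\<Sum>g\<in>Gu. \<Sum>q\<in>fire_plans I g. \<Sum>d = 0..card (crews I).
        of_bool (plan_demand I g q t = d) * \<delta> g d * y g q)
    + (\<Sum>j\<in>Ju. \<Sum>p\<in>crew_routes I j.
        of_bool ((\<Sum>g\<in>Gu. route_works I j p g t) = 0) * z j p)
    \<le> real (card Ju) + K"
proof -
  have "\<exists>q\<in>fire_plans I g. \<forall>h. (\<Sum>b\<in>fire_plans I g. h b * y g b) = h q" if "g \<in> fires I" for g
    using feasible that
    by (intro binary_sum_1_selects finite_fire_plans) (auto simp: sp_feasible_def)
  then obtain Q where "Q g \<in> fire_plans I g"
      and Q: "(\<Sum>b\<in>fire_plans I g. h b * y g b) = h (Q g)" if "g \<in> fires I" for g h
    by metis
  have "\<exists>p\<in>crew_routes I j. \<forall>h. (\<Sum>b\<in>crew_routes I j. h b * z j b) = h p" if "j \<in> crews I" for j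
    using feasible that
    by (intro binary_sum_1_selects finite_crew_routes) (auto simp: sp_feasible_def)
  then obtain P where P_route: "P j \<in> crew_routes I j"
      and P: "(\<Sum>b\<in>crew_routes I j. h b * z j b) = h (P j)" if "j \<in> crews I" for j h
    by metis
  define D where "D g = plan_demand I g (Q g) t" for g
  define W where "W j g = route_works I j (P j) g t" for j g
  define U where "U = {j \<in> Ju. (\<Sum>g\<in>Gu. W j g) = 0}"
  have finG: "finite Gu" and finJ: "finite Ju"
    using Gu Ju finite_fires finite_crews finite_subset by blast+

  have demand_met: "D g \<le> (\<Sum>j\<in>crews I. W j g)" if "g \<in> fires I" for g
  proof -
    have "(\<Sum>j\<in>crews I. \<Sum>p\<in>crew_routes I j. real (route_works I j p g t) * z j p)
        - (\<Sum>q\<in>fire_plans I g. real (plan_demand I g q t) * y g q) \<ge> 0"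
      using feasible that assms(1) by (auto simp: sp_feasible_def)
    then have "real (D g) \<le> real (\<Sum>j\<in>crews I. W j g)"
      using that by (simp add: P Q D_def W_def)
    then show ?thesis by linarith
  qed
  have D_le: "D g \<le> card (crews I)" if "g \<in> Gu" for g
  proof -
    have "(\<Sum>j\<in>crews I. W j g) \<le> (\<Sum>j\<in>crews I. 1)"
      by (intro sum_mono) (simp add: W_def route_works_def)
    then show ?thesis using demand_met[of g] that Gu by auto
  qed

  \<comment> \<open>Counting the assignments by crew instead of by fire: a crew of \<open>U\<close> serves no fire of \<open>Gu\<close>,
    any other crew at most one.\<close>
  have "(\<Sum>g\<in>Gu. D g) \<le> (\<Sum>g\<in>Gu. \<Sum>j\<in>crews I. W j g)"
    using demand_met Gu by (intro sum_mono) blast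
  also have "\<dots> = (\<Sum>j\<in>crews I. \<Sum>g\<in>Gu. W j g)"
    by (rule sum.swap)
  also have "\<dots> \<le> (\<Sum>j\<in>crews I. of_bool (j \<notin> U))"
    using route_works_sum_le_1 P_route by (intro sum_mono) (auto simp: U_def W_def)
  also have "\<dots> = card (crews I - U)"
    using finite_crews by (simp add: set_diff_eq Int_def)
  also have "\<dots> = card (crews I) - card U"
    using Ju finJ by (intro card_Diff_subset) (auto simp: U_def)
  finally have total: "(\<Sum>g\<in>Gu. D g) + card U \<le> card (crews I)"
    using card_mono[OF finite_crews, of U] Ju by (force simp: U_def)

  have "(\<Sum>q\<in>fire_plans I g. \<Sum>d = 0..card (crews I).
        of_bool (plan_demand I g q t = d) * \<delta> g d * y g q) = \<delta> g (D g)" if "g \<in> Gu" for g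
  proof -
    have "(\<Sum>q\<in>fire_plans I g. \<Sum>d = 0..card (crews I).
          of_bool (plan_demand I g q t = d) * \<delta> g d * y g q)
        = (\<Sum>d = 0..card (crews I). of_bool (D g = d) * \<delta> g d)"
      unfolding sum_distrib_right[symmetric] using that Gu by (subst Q) (auto simp: D_def)
    also have "\<dots> = \<delta> g (D g)"
      using D_le[OF that] by (simp add: of_bool_def if_distrib[of "\<lambda>x. x * _"] cong: if_cong)
    finally show ?thesis .
  qed
  moreover have "(\<Sum>j\<in>Ju. \<Sum>p\<in>crew_routes I j.
      of_bool ((\<Sum>g\<in>Gu. route_works I j p g t) = 0) * z j p) = real (card U)"
  proof -
    have "(\<Sum>p\<in>crew_routes I j. of_bool ((\<Sum>g\<in>Gu. route_works I j p g t) = 0) * z j p)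
        = of_bool ((\<Sum>g\<in>Gu. W j g) = 0)" if "j \<in> Ju" for j
      using that Ju by (subst P) (auto simp: W_def)
    then have "(\<Sum>j\<in>Ju. \<Sum>p\<in>crew_routes I j.
        of_bool ((\<Sum>g\<in>Gu. route_works I j p g t) = 0) * z j p)
        = (\<Sum>j\<in>Ju. of_bool ((\<Sum>g\<in>Gu. W j g) = 0))"
      by (rule sum.cong[OF refl])
    also have "\<dots> = real (card U)"
      unfolding U_def using finJ by (subst sum_of_bool_eq) (auto simp: Int_def)
    finally show ?thesis .
  qed
  ultimately show ?thesis
    using allotment_bound[OF Gu Ju _ weights bound D_le total] by (simp add: U_def)
qed

end

section \<open>Extension to the convex hull\<close>

lemma convex_double_sum_halfspace:
  fixes a :: "'a \<Rightarrow> 'b \<Rightarrow> real" and b :: "'c \<Rightarrow> 'd \<Rightarrow> real"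
  shows "convex {(y, z). (\<Sum>i\<in>A. \<Sum>k\<in>B i. a i k * y i k) + (\<Sum>i\<in>C. \<Sum>k\<in>E i. b i k * z i k) \<le> c}"
proof -
  define L where "L = (\<lambda>(y, z). (\<Sum>i\<in>A. \<Sum>k\<in>B i. a i k * y i k) + (\<Sum>i\<in>C. \<Sum>k\<in>E i. b i k * z i k))"
  have "linear L"
    by (rule linearI)
      (auto simp: L_def scaleR_fun_def sum.distrib sum_distrib_left algebra_simps)
  then have "convex (L -` {..c})"
    by (intro convex_linear_vimage) auto
  moreover have "L -` {..c} = {(y, z).
      (\<Sum>i\<in>A. \<Sum>k\<in>B i. a i k * y i k) + (\<Sum>i\<in>C. \<Sum>k\<in>E i. b i k * z i k) \<le> c}"
    by (auto simp: L_def)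
  ultimately show ?thesis by simp
qed

theorem theorem2:
  fixes I :: "('l, 'j, 's) sp_data"
    and t :: nat and Gu :: "'l set" and Ju :: "'j set"
    and \<delta> :: "'l \<Rightarrow> nat \<Rightarrow> real" and K :: real
  assumes "sp_instance I"
    and "t \<in> periods I"
    and "Gu \<subseteq> fires I"
    and "Ju \<subseteq> crews I"
    and "\<forall>g\<in>Gu. \<forall>d\<in>{0..card (crews I)}. \<delta> g d \<in> {0..1}"
    and "\<forall>S\<in>allotments I Gu Ju. (\<Sum>(g, d)\<in>S. \<delta> g d) \<le> K"
  shows "\<forall>(y, z) \<in> convex hull (sp_feasible I).
    (\<Sum>g\<in>Gu. \<Sum>q\<in>fire_plans I g. \<Sum>d = 0..card (crews I).
        of_bool (plan_demand I g q t = d) * \<delta> g d * y g q)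
    + (\<Sum>j\<in>Ju. \<Sum>p\<in>crew_routes I j.
        of_bool ((\<Sum>g\<in>Gu. route_works I j p g t) = 0) * z j p)
    \<le> real (card Ju) + K"
proof -
  interpret sp_instance I by (fact assms(1))
  let ?H = "{(y, z). (\<Sum>g\<in>Gu. \<Sum>q\<in>fire_plans I g. \<Sum>d = 0..card (crews I).
        of_bool (plan_demand I g q t = d) * \<delta> g d * y g q)
    + (\<Sum>j\<in>Ju. \<Sum>p\<in>crew_routes I j.
        of_bool ((\<Sum>g\<in>Gu. route_works I j p g t) = 0) * z j p)
    \<le> real (card Ju) + K}"
  have "sp_feasible I \<subseteq> ?H"
  proof clarify
    fix y z
    assume "(y, z) \<in> sp_feasible I"
    then show "(\<Sum>g\<in>Gu. \<Sum>q\<in>fire_plans I g. \<Sum>d = 0..card (crews I).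
        of_bool (plan_demand I g q t = d) * \<delta> g d * y g q)
      + (\<Sum>j\<in>Ju. \<Sum>p\<in>crew_routes I j.
        of_bool ((\<Sum>g\<in>Gu. route_works I j p g t) = 0) * z j p)
      \<le> real (card Ju) + K"
      using assms(2-6) by (intro feasible_point_bound) auto
  qed
  moreover have "convex ?H"
    \<comment> \<open>The sum over \<open>d\<close> is the coefficient of \<open>y g q\<close>.\<close>
    unfolding sum_distrib_right[symmetric] by (rule convex_double_sum_halfspace)
  ultimately have "convex hull (sp_feasible I) \<subseteq> ?H"
    by (rule hull_minimal)
  then show ?thesis by blast
qed

end
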